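(* Let $f:(0,\infty)\to(0,\infty)$ and let $k,\nu>0$. Suppose that (i) $f(k\nu)=1$; (ii) $f(x+k\nu)=x\,\nu^{-2}f(x)$ for all $x>0$; (iii) $f$ is logarithmically convex. Then $f(x)=\Gamma_{k,\nu}(x)$ for all $x\in(0,\infty)$.
   Context: For $k>0$, $\nu>0$, the $(k,\nu)$ Gamma function is defined (here for $x>0$) by $$\Gamma_{k,\nu}(x)=\lim_{n\to\infty}\frac{n!\,(k\nu)^n\left(\frac{nk}{\nu}\right)^{\frac{x}{k\nu}-1}}{(x)_{n,k\nu}},$$ where for $a\in\mathbb{R}$ and $n\in\mathbb{N}$, $(x)_{n,a}=x(x+a)\cdots(x+(n-1)a)$. A function $f:(0,\infty)\to(0,\infty)$ is logarithmically convex if $\ln f$ is convex. *)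

theory Defs
  imports "HOL-Analysis.Analysis"
begin

definition step_pochhammer :: "real \<Rightarrow> nat \<Rightarrow> real \<Rightarrow> real" where
  "step_pochhammer x n a = (\<Prod>i<n. x + real i * a)"

text \<open>
  The limit exists for \<open>k, \<nu>, x > 0\<close>. The base of \<open>powr\<close> is positive for all \<open>n \<ge> 1\<close>,
  so \<open>powr\<close> is the usual real power there.
\<close>
definition Gamma_k_nu :: "real \<Rightarrow> real \<Rightarrow> real \<Rightarrow> real" where
  "Gamma_k_nu k \<nu> x =
     lim (\<lambda>n. fact n * (k * \<nu>) ^ n * (real n * k / \<nu>) powr (x / (k * \<nu>) - 1)
              / step_pochhammer x n (k * \<nu>))"

definition log_convex_on :: "real set \<Rightarrow> (real \<Rightarrow> real) \<Rightarrow> bool" where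
  "log_convex_on S f \<longleftrightarrow> (\<forall>x\<in>S. f x > 0) \<and> convex_on S (\<lambda>x. ln (f x))"

end

theory Submission imports Defs begin

text \<open>
  Everything reduces to Euler's Gamma function by measuring \<open>x\<close> in units of the step \<open>k * \<nu>\<close>.
  Put \<open>u = x / (k * \<nu>)\<close>. The \<open>n\<close>-th term of the sequence defining \<^term>\<open>Gamma_k_nu k \<nu> x\<close> is then
  \<open>(k / \<nu>) powr (u - 1)\<close> times the \<open>n\<close>-th term of Euler's product for \<^term>\<open>Gamma u\<close>, whence
  \<open>Gamma_k_nu k \<nu> x = (k / \<nu>) powr (u - 1) * Gamma u\<close> (lemma \<open>Gamma_k_nu_eq_Gamma\<close>).

  On the other side, \<open>G u = (k / \<nu>) powr (1 - u) * f (k * \<nu> * u)\<close> satisfies the hypotheses of the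
  Bohr--Mollerup theorem. In terms of \<open>u\<close>, the functional equation of \<open>f\<close> has the factor
  \<open>k * \<nu> * u / \<nu>\<^sup>2 = (k / \<nu>) * u\<close>, and the exponential prefactor cancels its constant part \<open>k / \<nu>\<close>;
  \<open>ln G\<close> is the convex function \<open>ln f\<close>, precomposed with a linear map, plus an affine function.
  So \<open>G\<close> is \<^const>\<open>Gamma\<close>, and undoing the substitution gives the claim.
\<close>

lemma step_pochhammer_scale:
  "step_pochhammer (a * u) n a = a ^ n * pochhammer u n"
proof -
  have "step_pochhammer (a * u) n a = (\<Prod>i<n. a * (u + real i))"
    by (simp add: step_pochhammer_def algebra_simps)
  also have "\<dots> = a ^ n * pochhammer u n"
    by (simp add: prod.distrib pochhammer_prod atLeast0LessThan)
  finally show ?thesis .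
qed

text \<open>
  In the defining sequence the powers of \<open>k * \<nu>\<close> cancel against those in the Pochhammer symbol, and
  the constant part of \<open>(n * k / \<nu>) powr (u - 1)\<close> splits off, which leaves Euler's product.
\<close>
lemma Gamma_k_nu_eq_Gamma:
  assumes "k > 0" "\<nu> > 0"
  shows "Gamma_k_nu k \<nu> x = (k / \<nu>) powr (x / (k * \<nu>) - 1) * Gamma (x / (k * \<nu>))"
proof -
  define u where "u = x / (k * \<nu>)"
  have x: "x = k * \<nu> * u"
    using assms by (simp add: u_def)
  have "fact n * (k * \<nu>) ^ n * (real n * k / \<nu>) powr (u - 1) / step_pochhammer x n (k * \<nu>)
          = (k / \<nu>) powr (u - 1) * Gamma_series' u n" if n: "n > 0" for n
  proof -
    have "(real n * k / \<nu>) powr (u - 1) = (real n * (k / \<nu>)) powr (u - 1)"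
      by simp
    also have "\<dots> = real n powr (u - 1) * (k / \<nu>) powr (u - 1)"
      using assms by (subst powr_mult) auto
    finally have split: "(real n * k / \<nu>) powr (u - 1) = real n powr (u - 1) * (k / \<nu>) powr (u - 1)" .
    have "fact n * real n powr (u - 1) = fact (n - 1) * (real n * real n powr (u - 1))"
      using n by (simp add: fact_reduce)
    also have "real n * real n powr (u - 1) = exp (u * ln (real n))"
      using n powr_mult_base[of "real n" "u - 1"] by (simp add: powr_def[of _ u])
    finally have euler: "fact n * real n powr (u - 1) = fact (n - 1) * exp (u * ln (real n))" .
    have "fact n * (k * \<nu>) ^ n * (real n * k / \<nu>) powr (u - 1) / step_pochhammer x n (k * \<nu>)
            = (k * \<nu>) ^ n * ((k / \<nu>) powr (u - 1) * (fact n * real n powr (u - 1)))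
                / ((k * \<nu>) ^ n * pochhammer u n)"
      unfolding split x step_pochhammer_scale by (simp only: mult_ac)
    also have "\<dots> = (k / \<nu>) powr (u - 1) * (fact n * real n powr (u - 1)) / pochhammer u n"
      using assms by (intro mult_divide_mult_cancel_left) simp
    also have "\<dots> = (k / \<nu>) powr (u - 1) * Gamma_series' u n"
      by (simp add: euler Gamma_series'_def)
    finally show ?thesis .
  qed
  then have "\<forall>\<^sub>F n in sequentially. (k / \<nu>) powr (u - 1) * Gamma_series' u n
        = fact n * (k * \<nu>) ^ n * (real n * k / \<nu>) powr (u - 1) / step_pochhammer x n (k * \<nu>)"
    by (intro eventually_mono[OF eventually_gt_at_top[of 0]]) simp
  moreover have "(\<lambda>n. (k / \<nu>) powr (u - 1) * Gamma_series' u n)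
      \<longlonglongrightarrow> (k / \<nu>) powr (u - 1) * Gamma u"
    by (intro tendsto_mult tendsto_const Gamma_series'_LIMSEQ)
  ultimately have "(\<lambda>n. fact n * (k * \<nu>) ^ n * (real n * k / \<nu>) powr (u - 1)
                      / step_pochhammer x n (k * \<nu>)) \<longlonglongrightarrow> (k / \<nu>) powr (u - 1) * Gamma u"
    by (rule Lim_transform_eventually[rotated])
  then show ?thesis
    unfolding Gamma_k_nu_def u_def by (rule limI)
qed

lemma convex_on_eq_on:
  assumes "\<And>x. x \<in> S \<Longrightarrow> g x = f x" "convex_on S f"
  shows "convex_on S g"
proof (rule convex_onI)
  show S: "convex S"
    using assms(2) by (rule convex_on_imp_convex)
  show "g ((1 - t) *\<^sub>R x + t *\<^sub>R y) \<le> (1 - t) * g x + t * g y"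
    if "0 < t" "t < 1" "x \<in> S" "y \<in> S" for t x y
    using that assms(1) convex_onD[OF assms(2), of t x y] convexD[OF S, of x y "1 - t" t] by simp
qed

lemma convex_on_scale_argument:
  fixes g :: "real \<Rightarrow> real"
  assumes "convex_on {0<..} g" "a > 0"
  shows "convex_on {0<..} (\<lambda>u. g (a * u))"
proof (rule convex_onI)
  fix t u v :: real
  assume "0 < t" "t < 1" "u \<in> {0<..}" "v \<in> {0<..}"
  then have "g ((1 - t) *\<^sub>R (a * u) + t *\<^sub>R (a * v)) \<le> (1 - t) * g (a * u) + t * g (a * v)"
    using assms by (intro convex_onD[OF assms(1)]) auto
  moreover have "(1 - t) *\<^sub>R (a * u) + t *\<^sub>R (a * v) = a * ((1 - t) *\<^sub>R u + t *\<^sub>R v)"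
    by (simp add: algebra_simps)
  ultimately show "g (a * ((1 - t) *\<^sub>R u + t *\<^sub>R v)) \<le> (1 - t) * g (a * u) + t * g (a * v)"
    by simp
qed simp

text \<open>
  The rescaled function \<open>u \<mapsto> c powr (1 - u) * f (a * u)\<close> satisfies the Bohr--Mollerup theorem. Since
  \<open>c powr (1 - u)\<close> is divided by \<open>c\<close> when \<open>u\<close> grows by \<open>1\<close>, it removes the factor \<open>c\<close> from the
  functional equation; it changes the logarithm only by an affine term, which keeps convexity; and
  it equals \<open>1\<close> at \<open>u = 1\<close>, which keeps the normalisation.
\<close>
lemma Bohr_Mollerup_scaled:
  fixes f :: "real \<Rightarrow> real"
  assumes "a > 0" "c > 0"
    and pos: "\<And>x. x > 0 \<Longrightarrow> f x > 0"
    and "f a = 1"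
    and step: "\<And>x. x > 0 \<Longrightarrow> f (x + a) = c * (x / a) * f x"
    and convex: "convex_on {0<..} (\<lambda>x. ln (f x))"
    and "x > 0"
  shows "f x = c powr (x / a - 1) * Gamma (x / a)"
proof -
  define G where "G u = c powr (1 - u) * f (a * u)" for u
  have G_pos: "G u > 0" if "u > 0" for u
    using that assms by (simp add: G_def)
  have G_1: "G 1 = 1"
    using assms by (simp add: G_def)
  have G_plus1: "G (u + 1) = u * G u" if "u > 0" for u
  proof -
    have "f (a * (u + 1)) = c * u * f (a * u)"
      using step[of "a * u"] that \<open>a > 0\<close> by (simp add: algebra_simps)
    moreover have "c powr (1 - u) = c * c powr (1 - (u + 1))"
      using \<open>c > 0\<close> by (simp add: powr_diff powr_minus field_simps)
    ultimately show ?thesis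
      by (simp add: G_def)
  qed
  have "convex_on {0<..} (\<lambda>u. (1 - u) * ln c)"
    by (rule convex_onI) (simp_all add: algebra_simps)
  then have "convex_on {0<..} (\<lambda>u. (1 - u) * ln c + ln (f (a * u)))"
    by (intro convex_on_add convex_on_scale_argument[OF convex \<open>a > 0\<close>])
  moreover have "(ln \<circ> G) u = (1 - u) * ln c + ln (f (a * u))" if "u \<in> {0<..}" for u
  proof -
    have "f (a * u) > 0"
      using that pos \<open>a > 0\<close> by simp
    then show ?thesis
      using \<open>c > 0\<close> by (simp add: G_def ln_mult ln_powr)
  qed
  ultimately have "convex_on {0<..} (ln \<circ> G)"
    by (rule convex_on_eq_on[rotated]) simp
  then have "G (x / a) = Gamma (x / a)"
    using Gamma_pos_real_unique[of G, OF G_1 G_plus1 G_pos] assms by simp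
  moreover have "c powr (x / a - 1) * G (x / a) = f x"
    using assms by (simp add: G_def mult.assoc[symmetric] powr_add[symmetric])
  ultimately show ?thesis
    by simp
qed

theorem theorem2p3:
  fixes f :: "real \<Rightarrow> real" and k \<nu> :: real
  assumes "k > 0" and "\<nu> > 0"
    and "\<And>x. x > 0 \<Longrightarrow> f x > 0"
    and "f (k * \<nu>) = 1"
    and "\<And>x. x > 0 \<Longrightarrow> f (x + k * \<nu>) = x * \<nu> powi (-2) * f x"
    and "log_convex_on {0<..} f"
  shows "\<forall>x\<in>{0<..}. f x = Gamma_k_nu k \<nu> x"
proof
  fix x :: real
  assume "x \<in> {0<..}"
  have factor: "y * \<nu> powi (-2) = (k / \<nu>) * (y / (k * \<nu>))" for y
    using assms(1,2) by (simp add: power_int_minus field_simps power2_eq_square)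
  have "f x = (k / \<nu>) powr (x / (k * \<nu>) - 1) * Gamma (x / (k * \<nu>))"
  proof (rule Bohr_Mollerup_scaled)
    show "f (y + k * \<nu>) = (k / \<nu>) * (y / (k * \<nu>)) * f y" if "y > 0" for y
      using assms(5)[OF that] unfolding factor .
    show "convex_on {0<..} (\<lambda>x. ln (f x))"
      using assms(6) by (simp add: log_convex_on_def)
  qed (use assms(1-4) \<open>x \<in> {0<..}\<close> in auto)
  then show "f x = Gamma_k_nu k \<nu> x"
    using assms(1,2) by (simp add: Gamma_k_nu_eq_Gamma)
qed

end
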